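(* Let $S=\langle n,m\rangle\neq\mathbb{N}$ be a numerical semigroup with $\gcd(n,m)=1$ and $n<m$. Let $a=\lambda n+\mu m\in S$ with $\lambda,\mu\in\mathbb{N}$ and $\mu<n$, and consider the dilatation $T=S+a$. Then: (i) If $\lambda=0$, the set of minimal generators of $T$ is \[ \{n+2a\}\cup\{ym+a \mid 1\leq y\leq \mu+1\}\cup\{xn+ym+a \mid 1\leq x\leq m-1 \text{ and } 0\leq y\leq \mu-1\}. \] (ii) If $\lambda>0$, the set of minimal generators of $T$ is \begin{gather*} \{n+2a\}\cup\{ym+a \mid 1\leq y\leq n-1\}\,\cup\\ \cup\,\{xn+ym+a \mid 1\leq x\leq \lambda-1 \text{ and } 0\leq y\leq n+\mu-1\}\,\cup\\ \cup\,\{\lambda n+ym+a \mid 0\leq y\leq \mu+1\}\cup\{xn+ym+a \mid \lambda+1\leq x\leq m \text{ and } 0\leq y\leq \mu-1\}. \end{gather*} Here $x,y$ range over integers, and a set whose index range is empty is empty.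
   Context: $\mathbb{N}$ denotes the nonnegative integers. A numerical semigroup is a submonoid $S$ of $(\mathbb{N},+)$ with $\mathbb{N}\setminus S$ finite; $\langle n,m\rangle=\{xn+ym : x,y\in\mathbb{N}\}$. For $a\in S$, the dilatation of $S$ with respect to $a$ is the numerical semigroup $S+a=\{0\}\cup\{s+a : s\in S\setminus\{0\}\}$ (so here $S+a$ is not the full translate of $S$). The minimal generators of a numerical semigroup are the elements of its unique minimal generating set as a monoid. *)

theory Defs
  imports Complex_Main
begin

definition add_submonoid :: "nat set \<Rightarrow> bool" where
  "add_submonoid M \<longleftrightarrow> 0 \<in> M \<and> (\<forall>x\<in>M. \<forall>y\<in>M. x + y \<in> M)"

definition numerical_semigroup :: "nat set \<Rightarrow> bool" where
  "numerical_semigroup S \<longleftrightarrow> add_submonoid S \<and> finite (UNIV - S)"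

definition gen2 :: "nat \<Rightarrow> nat \<Rightarrow> nat set" where
  "gen2 n m = {x * n + y * m | x y. True}"

definition dilatation :: "nat set \<Rightarrow> nat \<Rightarrow> nat set" where
  "dilatation S a = {0} \<union> {s + a | s. s \<in> S - {0}}"

text \<open>The library term \<^term>\<open>add_submonoid hull G\<close> is the intersection of all submonoids
  containing \<^term>\<open>G\<close>, i.e. the submonoid generated by \<^term>\<open>G\<close>.\<close>

definition minimal_generating_set :: "nat set \<Rightarrow> nat set \<Rightarrow> bool" where
  "minimal_generating_set S G \<longleftrightarrow>
     add_submonoid hull G = S \<and> (\<forall>H. H \<subset> G \<longrightarrow> add_submonoid hull H \<noteq> S)"

definition minimal_generators :: "nat set \<Rightarrow> nat set" where
  "minimal_generators S = (THE G. minimal_generating_set S G)"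

text \<open>The definite description is legitimate: every submonoid of the naturals has exactly one
  minimal generating set.\<close>

lemma ex1_minimal_generating_set:
  assumes T: "add_submonoid T"
  shows "\<exists>!G. minimal_generating_set T G"
proof -
  define I where "I = {t \<in> T - {0}. \<not> (\<exists>u\<in>T - {0}. \<exists>v\<in>T - {0}. t = u + v)}"
  have zero: "0 \<in> add_submonoid hull A" for A
    by (auto simp: hull_def add_submonoid_def)
  have plus: "x + y \<in> add_submonoid hull A"
    if "x \<in> add_submonoid hull A" "y \<in> add_submonoid hull A" for x y A
    using that by (auto simp: hull_def add_submonoid_def)
  have gen: "t \<in> add_submonoid hull I" if "t \<in> T" for t
    using that
  proof (induction t rule: less_induct)
    case (less t)
    show ?case
    proof (cases "t = 0 \<or> t \<in> I")
      case True
      then show ?thesis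
        using zero[of I] hull_subset[of I add_submonoid] by blast
    next
      case False
      then obtain u v where uv: "u \<in> T - {0}" "v \<in> T - {0}" "t = u + v"
        using less.prems unfolding I_def by blast
      then have "u \<in> add_submonoid hull I" "v \<in> add_submonoid hull I"
        using less.IH by auto
      then show ?thesis
        using plus uv(3) by simp
    qed
  qed
  have "add_submonoid hull I \<subseteq> T"
    by (rule hull_minimal) (auto simp: I_def T)
  then have hI: "add_submonoid hull I = T"
    using gen by blast
  have least: "I \<subseteq> G" if G: "add_submonoid hull G = T" for G
  proof
    fix x assume x: "x \<in> I"
    show "x \<in> G"
    proof (rule ccontr)
      assume "x \<notin> G"
      then have "G \<subseteq> T - {x}"
        using G hull_subset[of G add_submonoid] by auto
      moreover have "add_submonoid (T - {x})"
        unfolding add_submonoid_def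
      proof (intro conjI ballI)
        show "0 \<in> T - {x}"
          using T x by (auto simp: add_submonoid_def I_def)
        fix p q assume pq: "p \<in> T - {x}" "q \<in> T - {x}"
        then have "p + q \<in> T"
          using T by (auto simp: add_submonoid_def)
        moreover have "p + q \<noteq> x"
          using pq x unfolding I_def by (cases "p = 0"; cases "q = 0") auto
        ultimately show "p + q \<in> T - {x}" by simp
      qed
      ultimately have "add_submonoid hull G \<subseteq> T - {x}"
        by (rule hull_minimal)
      then show False using G x by (auto simp: I_def)
    qed
  qed
  show ?thesis
  proof (rule ex1I[of _ I])
    show "minimal_generating_set T I"
      unfolding minimal_generating_set_def using hI least by blast
    show "G = I" if "minimal_generating_set T G" for G
      using that hI least[of G] unfolding minimal_generating_set_def by blast
  qed
qed

end

theory Submission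
  imports Defs
begin

text \<open>An element \<open>s + a\<close> of the dilatation is a minimal generator iff \<open>s - a\<close> is not a sum of
  two nonzero elements of \<open>S\<close>, that is, not of the form \<open>x n + y m\<close> with \<open>x + y \<ge> 2\<close>.
  Two pairs of coefficients represent the same element iff they differ by a multiple
  of \<open>(m, -n)\<close>, so it remains to put each \<open>s\<close> into a suitable normal form and compare
  coefficients.\<close>

section \<open>Minimal generators as irreducible elements, and their form in a dilatation\<close>

text \<open>Over the naturals the summands of a proper sum are strictly smaller, so a sum is
  generated without itself and is redundant; removing an irreducible element from \<open>T\<close>
  leaves a submonoid, so every generating set contains it.\<close>

lemma minimal_generators_eq_irreducibles:
  assumes T: "add_submonoid T"
  shows "minimal_generators T = {t \<in> T - {0}. \<forall>u\<in>T - {0}. \<forall>v\<in>T - {0}. t \<noteq> u + v}" (is "_ = ?I")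
proof -
  define G where "G = minimal_generators T"
  have "minimal_generating_set T G"
    unfolding G_def minimal_generators_def
    by (rule theI'[OF ex1_minimal_generating_set[OF T]])
  then have hG: "add_submonoid hull G = T"
    and minG: "\<And>H. H \<subset> G \<Longrightarrow> add_submonoid hull H \<noteq> T"
    by (auto simp: minimal_generating_set_def)
  have GT: "G \<subseteq> T"
    using hull_subset[of G add_submonoid] hG by simp
  have "G \<subseteq> ?I"
  proof
    fix t assume t: "t \<in> G"
    define H where "H = add_submonoid hull (G - {t})"
    have H: "add_submonoid H"
      unfolding H_def by (rule hull_in) (auto simp: add_submonoid_def)
    have GH: "G - {t} \<subseteq> H"
      unfolding H_def by (rule hull_subset)
    have tH: "t \<notin> H"
    proof
      assume "t \<in> H"
      then have "G \<subseteq> H" using GH by blast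
      then have "T \<subseteq> H" using hull_minimal[of G H add_submonoid] H hG by simp
      moreover have "H \<subseteq> T"
        using GT T unfolding H_def by (intro hull_minimal) auto
      ultimately show False using minG[of "G - {t}"] t unfolding H_def by blast
    qed
    \<comment> \<open>Closed under addition because summands of a number below \<open>t\<close> are
      themselves below \<open>t\<close>. It contains \<open>G\<close>, as \<open>t\<close> is the
      only generator possibly outside \<open>H\<close>. So every element of \<open>T\<close> below
      \<open>t\<close> is generated without \<open>t\<close>.\<close>
    have "add_submonoid {x. x < t \<longrightarrow> x \<in> H}"
      using H by (auto simp: add_submonoid_def)
    then have "add_submonoid hull G \<subseteq> {x. x < t \<longrightarrow> x \<in> H}"
      using GH by (intro hull_minimal) auto
    then have below: "x \<in> H" if "x \<in> T" "x < t" for x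
      using hG that by auto
    have "t \<noteq> u + v" if "u \<in> T - {0}" "v \<in> T - {0}" for u v
    proof
      assume "t = u + v"
      then have "u \<in> H" "v \<in> H" using that below by auto
      then show False using H tH \<open>t = u + v\<close> by (auto simp: add_submonoid_def)
    qed
    moreover have "t \<noteq> 0" using H tH by (metis add_submonoid_def)
    ultimately show "t \<in> ?I" using t GT by blast
  qed
  moreover have "?I \<subseteq> G"
  proof
    fix x assume x: "x \<in> ?I"
    show "x \<in> G"
    proof (rule ccontr)
      assume "x \<notin> G"
      then have "G \<subseteq> T - {x}" using GT by blast
      moreover have "add_submonoid (T - {x})"
        unfolding add_submonoid_def
      proof (intro conjI ballI)
        show "0 \<in> T - {x}" using T x by (auto simp: add_submonoid_def)
        fix p q assume pq: "p \<in> T - {x}" "q \<in> T - {x}"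
        then have "p + q \<in> T" using T by (auto simp: add_submonoid_def)
        \<comment> \<open>If one summand is zero, the other would be \<open>x\<close> itself; if
          both are nonzero, \<open>x\<close> would be reducible.\<close>
        moreover have "p + q \<noteq> x"
          using pq x by (cases "p = 0"; cases "q = 0") auto
        ultimately show "p + q \<in> T - {x}" by simp
      qed
      ultimately have "add_submonoid hull G \<subseteq> T - {x}" by (rule hull_minimal)
      then show False using hG x by auto
    qed
  qed
  ultimately show ?thesis unfolding G_def by blast
qed

lemma add_submonoid_dilatation:
  assumes S: "add_submonoid S" and "a \<in> S"
  shows "add_submonoid (dilatation S a)"
  unfolding add_submonoid_def
proof (intro conjI ballI)
  show "0 \<in> dilatation S a" by (simp add: dilatation_def)
  fix x y assume xy: "x \<in> dilatation S a" "y \<in> dilatation S a"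
  show "x + y \<in> dilatation S a"
  proof (cases "x = 0 \<or> y = 0")
    case True
    then show ?thesis using xy by auto
  next
    case False
    then obtain s t where st: "s \<in> S - {0}" "t \<in> S - {0}" "x = s + a" "y = t + a"
      using xy by (auto simp: dilatation_def)
    \<comment> \<open>Regroup \<open>(s + a) + (t + a)\<close> as \<open>(s + t + a) + a\<close>;
      this is where \<open>a\<close> has to lie in \<open>S\<close>.\<close>
    have "s + t + a \<in> S - {0}"
      using S \<open>a \<in> S\<close> st by (auto simp: add_submonoid_def)
    then show ?thesis
      using st unfolding dilatation_def by (auto intro!: exI[of _ "s + t + a"] simp: add.assoc)
  qed
qed

text \<open>Each nonzero element of the dilatation carries one copy of \<open>a\<close>, so a sum of
  two carries two; cancelling one of them moves irreducibility back to a condition in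
  \<open>S\<close>.\<close>

lemma minimal_generators_dilatation:
  assumes "add_submonoid S" and "a \<in> S"
  shows "minimal_generators (dilatation S a) =
    {s + a | s. s \<in> S - {0} \<and> (\<forall>u\<in>S - {0}. \<forall>v\<in>S - {0}. s \<noteq> u + v + a)}"
proof -
  have nonzero: "dilatation S a - {0} = {s + a | s. s \<in> S - {0}}"
    by (auto simp: dilatation_def)
  have "(\<forall>u\<in>dilatation S a - {0}. \<forall>v\<in>dilatation S a - {0}. s + a \<noteq> u + v) \<longleftrightarrow>
      (\<forall>u\<in>S - {0}. \<forall>v\<in>S - {0}. s \<noteq> u + v + a)" for s
  proof -
    have "s + a = (u + a) + (v + a) \<longleftrightarrow> s = u + v + a" for u v
      by auto
    moreover have "(\<forall>u\<in>dilatation S a - {0}. P u) \<longleftrightarrow> (\<forall>u\<in>S - {0}. P (u + a))" for P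
      unfolding nonzero by auto
    ultimately show ?thesis by (simp add: ac_simps)
  qed
  moreover have "{t \<in> dilatation S a - {0}. P t} = {s + a | s. s \<in> S - {0} \<and> P (s + a)}" for P
    unfolding nonzero by auto
  ultimately show ?thesis
    unfolding minimal_generators_eq_irreducibles[OF add_submonoid_dilatation[OF assms]]
    by simp
qed

section \<open>Coefficient pairs over two generators\<close>

text \<open>A nonzero summand uses at least one generator, so two of them use at least two;
  conversely, one generator can be split off and something nonzero remains.\<close>

lemma gen2_sum_of_two_nonzero_iff:
  assumes "0 < n" and "0 < m"
  shows "(\<exists>u\<in>gen2 n m - {0}. \<exists>v\<in>gen2 n m - {0}. s = u + v) \<longleftrightarrow>
    (\<exists>x y. 2 \<le> x + y \<and> s = x * n + y * m)"
proof
  assume "\<exists>u\<in>gen2 n m - {0}. \<exists>v\<in>gen2 n m - {0}. s = u + v"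
  then obtain u v where "u \<in> gen2 n m - {0}" "v \<in> gen2 n m - {0}" "s = u + v" by blast
  then obtain x y x' y' where
    *: "s = (x * n + y * m) + (x' * n + y' * m)" "x * n + y * m \<noteq> 0" "x' * n + y' * m \<noteq> 0"
    by (auto simp: gen2_def)
  then have "0 < x + y" "0 < x' + y'" by (auto intro: gr0I)
  then have "2 \<le> (x + x') + (y + y')" by linarith
  moreover have "s = (x + x') * n + (y + y') * m"
    using * by (simp add: algebra_simps)
  ultimately show "\<exists>x y. 2 \<le> x + y \<and> s = x * n + y * m" by blast
next
  assume "\<exists>x y. 2 \<le> x + y \<and> s = x * n + y * m"
  then obtain x y where xy: "2 \<le> x + y" "s = x * n + y * m" by blast
  have mem: "i * n + j * m \<in> gen2 n m" for i j
    by (auto simp: gen2_def)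
  show "\<exists>u\<in>gen2 n m - {0}. \<exists>v\<in>gen2 n m - {0}. s = u + v"
  proof (cases x)
    case 0
    then obtain y' where "y = Suc y'" "0 < y'" using xy by (cases y) auto
    then show ?thesis
      using mem[of 0 1] mem[of 0 y'] xy 0 assms
      by (intro bexI[of _ m] bexI[of _ "y' * m"]) auto
  next
    case (Suc x')
    then have "0 < x' + y" using xy by linarith
    then show ?thesis
      using mem[of 1 0] mem[of x' y] xy Suc assms
      by (intro bexI[of _ n] bexI[of _ "x' * n + y * m"]) auto
  qed
qed

lemma minimal_generators_dilatation_gen2:
  assumes "0 < n" and "0 < m" and "a = l * n + \<mu> * m"
  shows "minimal_generators (dilatation (gen2 n m) a) =
    {i * n + j * m + a | i j. 0 < i + j \<and>
      (\<forall>x y. 2 \<le> x + y \<longrightarrow> i * n + j * m \<noteq> (x + l) * n + (y + \<mu>) * m)}"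
proof -
  have S: "add_submonoid (gen2 n m)"
    unfolding add_submonoid_def
  proof (intro conjI ballI)
    show "0 \<in> gen2 n m" by (auto simp: gen2_def)
    fix u v assume "u \<in> gen2 n m" "v \<in> gen2 n m"
    then obtain x y x' y' where "u = x * n + y * m" "v = x' * n + y' * m"
      by (auto simp: gen2_def)
    then have "u + v = (x + x') * n + (y + y') * m" by (simp add: algebra_simps)
    then show "u + v \<in> gen2 n m" unfolding gen2_def by blast
  qed
  have a: "a \<in> gen2 n m"
    using assms(3) by (auto simp: gen2_def)
  have irr: "(\<forall>u\<in>gen2 n m - {0}. \<forall>v\<in>gen2 n m - {0}. s \<noteq> u + v + a) \<longleftrightarrow>
      (\<forall>x y. 2 \<le> x + y \<longrightarrow> s \<noteq> (x + l) * n + (y + \<mu>) * m)" for s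
  \<comment> \<open>Truncated subtraction makes \<open>s - a\<close> meaningful only for
    \<open>a \<le> s\<close>; below \<open>a\<close> both sides hold trivially.\<close>
  proof (cases "a \<le> s")
    case False
    then have "s \<noteq> t + a" for t by auto
    moreover have "(x + l) * n + (y + \<mu>) * m = x * n + y * m + a" for x y
      using assms(3) by (simp add: algebra_simps)
    ultimately show ?thesis by metis
  next
    case True
    then have "s = t + a \<longleftrightarrow> s - a = t" for t by auto
    moreover have "(x + l) * n + (y + \<mu>) * m = x * n + y * m + a" for x y
      using assms(3) by (simp add: algebra_simps)
    ultimately show ?thesis
      using gen2_sum_of_two_nonzero_iff[OF assms(1,2), of "s - a"] by metis
  qed
  have "s \<in> gen2 n m - {0} \<longleftrightarrow> (\<exists>i j. 0 < i + j \<and> s = i * n + j * m)" for s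
    using assms(1,2) by (fastforce simp: gen2_def)
  then show ?thesis
    unfolding minimal_generators_dilatation[OF S a] irr by (intro Collect_cong) metis
qed

text \<open>Cancelling gives \<open>(p - i) n = (j - q) m\<close> over the integers, so coprimality
  makes the differences multiples of \<open>m\<close> and \<open>n\<close>. Keeping only the
  resulting inequalities leaves later comparisons to linear arithmetic.\<close>

lemma coprime_representation_cases:
  fixes n m i j p q :: nat
  assumes "coprime n m" and "0 < n" and "0 < m" and "i * n + j * m = p * n + q * m"
  shows "(p = i \<and> q = j) \<or> (i + m \<le> p \<and> q + n \<le> j) \<or> (p + m \<le> i \<and> j + n \<le> q)"
proof -
  have up: "(p = i \<and> q = j) \<or> (i + m \<le> p \<and> q + n \<le> j)"
    if "i \<le> p" and eq: "i * n + j * m = p * n + q * m" for i j p q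
  proof -
    from le_Suc_ex[OF that(1)] obtain d where d: "p = i + d" by blast
    then have "j * m = d * n + q * m" using eq by (simp add: algebra_simps)
    then have "q * m \<le> j * m" by simp
    then have "q \<le> j" using \<open>0 < m\<close> by simp
    then obtain e where e: "j = q + e" using le_Suc_ex[of q j] by blast
    have de: "d * n = e * m"
      using \<open>j * m = d * n + q * m\<close> e by (simp add: algebra_simps)
    show ?thesis
    proof (cases "d = 0")
      case True
      then show ?thesis using d e de \<open>0 < m\<close> by simp
    next
      case False
      then have "0 < e" using de \<open>0 < n\<close> by (auto intro: gr0I)
      have "m dvd d * n" "n dvd e * m"
        by (simp add: de, simp flip: de)
      then have "m dvd d" "n dvd e"
        using \<open>coprime n m\<close>
        by (simp_all add: coprime_dvd_mult_left_iff coprime_commute)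
      then have "m \<le> d" "n \<le> e"
        using False \<open>0 < e\<close> by (auto intro: dvd_imp_le)
      then show ?thesis
        unfolding d e by simp
    qed
  qed
  show ?thesis
  proof (cases "i \<le> p")
    case True
    then show ?thesis using up[OF True assms(4)] by blast
  next
    case False
    then show ?thesis using up[of p i q j] assms(4) by linarith
  qed
qed

section \<open>Normal forms of coefficient pairs and the two descriptions of the generators\<close>

theorem proposition2p5:
  fixes n m l \<mu> a :: nat and S T :: "nat set"
  assumes "S = gen2 n m"
    and "S \<noteq> UNIV"
    and "numerical_semigroup S"
    and "gcd n m = 1"
    and "n < m"
    and "a \<in> S"
    and "a = l * n + \<mu> * m"
    and "\<mu> < n"
    and "T = dilatation S a"
  shows "(l = 0 \<longrightarrow>
      minimal_generators T =
        {n + 2 * a}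
        \<union> {y * m + a | y. 1 \<le> y \<and> y \<le> \<mu> + 1}
        \<union> {x * n + y * m + a | x y. 1 \<le> x \<and> x \<le> m - 1 \<and> y < \<mu>})
    \<and> (l > 0 \<longrightarrow>
      minimal_generators T =
        {n + 2 * a}
        \<union> {y * m + a | y. 1 \<le> y \<and> y \<le> n - 1}
        \<union> {x * n + y * m + a | x y. 1 \<le> x \<and> x \<le> l - 1 \<and> y \<le> n + \<mu> - 1}
        \<union> {l * n + y * m + a | y. y \<le> \<mu> + 1}
        \<union> {x * n + y * m + a | x y. l + 1 \<le> x \<and> x \<le> m \<and> y < \<mu>})"
proof -
  \<comment> \<open>Otherwise one of the two generators equals 1 and \<open>S\<close> is all of the
    naturals.\<close>
  have "2 \<le> n"
  proof (rule ccontr)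
    assume "\<not> 2 \<le> n"
    then have "n = 0 \<or> n = 1" by linarith
    then consider "m = 1" | "n = 1"
      using \<open>gcd n m = 1\<close> by auto
    then have "x = 0 * n + x * m \<or> x = x * n + 0 * m" for x
      by cases auto
    then have "x \<in> S" for x
      unfolding \<open>S = gen2 n m\<close> gen2_def by blast
    then show False using \<open>S \<noteq> UNIV\<close> by blast
  qed
  then have pos: "0 < n" "0 < m" using \<open>n < m\<close> by auto
  have cop: "coprime n m"
    using \<open>gcd n m = 1\<close> by (simp add: coprime_iff_gcd_eq_1)
  note same = coprime_representation_cases[OF cop pos]
  \<comment> \<open>Although written with a pair, this depends only on the value
    \<open>i * n + j * m\<close>, so it can be transferred between representations.\<close>
  define irr where "irr i j \<longleftrightarrow> 0 < i + j \<and>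
    (\<forall>x y. 2 \<le> x + y \<longrightarrow> i * n + j * m \<noteq> (x + l) * n + (y + \<mu>) * m)" for i j
  have gens: "minimal_generators T = {i * n + j * m + a | i j. irr i j}"
    unfolding irr_def \<open>T = dilatation S a\<close> \<open>S = gen2 n m\<close>
    by (rule minimal_generators_dilatation_gen2[OF pos \<open>a = l * n + \<mu> * m\<close>])
  have genI: "i * n + j * m + a \<in> minimal_generators T" if "irr i j" for i j
    using that unfolding gens by blast
  \<comment> \<open>The three alternatives list every way a pair \<open>(x + l, y + \<mu>)\<close>
    can represent the same value as \<open>(i, j)\<close>.\<close>
  have irrI: "irr i j"
    if "0 < i + j"
      and "\<And>x y. \<lbrakk>2 \<le> x + y; (x + l = i \<and> y + \<mu> = j) \<or> (i + m \<le> x + l \<and> y + \<mu> + n \<le> j) \<or>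
        (x + l + m \<le> i \<and> j + n \<le> y + \<mu>)\<rbrakk> \<Longrightarrow> False" for i j
    unfolding irr_def
  proof (intro conjI allI impI notI)
    fix x y assume "2 \<le> x + y" "i * n + j * m = (x + l) * n + (y + \<mu>) * m"
    then show False using that(2) same by blast
  qed (rule that(1))
  have irrD: "i + j < 2 + l + \<mu>" if "irr i j" "l \<le> i" "\<mu> \<le> j" for i j
  proof (rule ccontr)
    assume "\<not> i + j < 2 + l + \<mu>"
    then have "2 \<le> (i - l) + (j - \<mu>)" using that by linarith
    then have "i * n + j * m \<noteq> (i - l + l) * n + (j - \<mu> + \<mu>) * m"
      using that(1) unfolding irr_def by blast
    then show False using that by simp
  qed
  have shift: "(i + k * m) * n + j * m = i * n + (j + k * n) * m" for i j k
    by (simp add: algebra_simps)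
  have irr_shift: "irr i (j + k * n)" if "irr (i + k * m) j" for i j k
    using that pos unfolding irr_def shift by (auto intro: gr0I)
  have irr_unshift: "irr (i + k * m) j" if "irr i (j + k * n)" for i j k
    using that pos unfolding irr_def shift by (auto intro: gr0I)
  have a_n: "n + 2 * a = (l + 1) * n + \<mu> * m + a"
    using \<open>a = l * n + \<mu> * m\<close> by simp
  have gen_a_n: "n + 2 * a \<in> minimal_generators T"
    unfolding a_n using \<open>2 \<le> n\<close> \<open>n < m\<close> by (intro genI irrI) auto
  show ?thesis
  proof (intro conjI impI)
    assume l: "l = 0"
    let ?R = "{n + 2 * a} \<union> {y * m + a | y. 1 \<le> y \<and> y \<le> \<mu> + 1}
        \<union> {x * n + y * m + a | x y. 1 \<le> x \<and> x \<le> m - 1 \<and> y < \<mu>}"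
    show "minimal_generators T = ?R"
    proof
      show "minimal_generators T \<subseteq> ?R"
      proof
        fix t assume "t \<in> minimal_generators T"
        then obtain i' j' where "t = i' * n + j' * m + a" "irr i' j'"
          unfolding gens by blast
        \<comment> \<open>Normal form with first coefficient below \<open>m\<close>; each removed
          \<open>m\<close> becomes \<open>n\<close> in the second.\<close>
        moreover define i j where "i = i' mod m" and "j = j' + i' div m * n"
        ultimately have t: "t = i * n + j * m + a" "irr i j" "i < m"
          using shift[of "i' mod m" "i' div m" j'] irr_shift[of "i' mod m" "i' div m" j'] pos
          by auto
        have ij: "0 < i + j" using t(2) by (simp add: irr_def)
        consider "i = 0" "1 \<le> j" "j \<le> \<mu> + 1" | "i = l + 1" "j = \<mu>"
          | "1 \<le> i" "i \<le> m - 1" "j < \<mu>"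
          using irrD[OF t(2)] ij t(3) l by linarith
        then show "t \<in> ?R"
        proof cases
          case 1
          then show ?thesis using t(1) by auto
        next
          case 2
          then show ?thesis using t(1) a_n by simp
        next
          case 3
          then show ?thesis using t(1) by blast
        qed
      qed
      have 1: "y * m + a \<in> minimal_generators T" if "1 \<le> y" "y \<le> \<mu> + 1" for y
      proof -
        \<comment> \<open>A competing pair with first coefficient at least \<open>m\<close> would
          need \<open>y\<close> to be at least \<open>\<mu> + n\<close>, excluded by
          \<open>2 \<le> n\<close>.\<close>
        have "irr 0 y" using that l \<open>2 \<le> n\<close> pos by (intro irrI) auto
        then show ?thesis using genI[of 0 y] by simp
      qed
      have 2: "x * n + y * m + a \<in> minimal_generators T" if "1 \<le> x" "x \<le> m - 1" "y < \<mu>" for x y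
        using that l pos by (intro genI irrI) auto
      show "?R \<subseteq> minimal_generators T"
        by (safe; (rule gen_a_n | (rule 1; assumption) | (rule 2; assumption)))
    qed
  next
    assume l: "0 < l"
    let ?R = "{n + 2 * a} \<union> {y * m + a | y. 1 \<le> y \<and> y \<le> n - 1}
        \<union> {x * n + y * m + a | x y. 1 \<le> x \<and> x \<le> l - 1 \<and> y \<le> n + \<mu> - 1}
        \<union> {l * n + y * m + a | y. y \<le> \<mu> + 1}
        \<union> {x * n + y * m + a | x y. l + 1 \<le> x \<and> x \<le> m \<and> y < \<mu>}"
    show "minimal_generators T = ?R"
    proof
      show "minimal_generators T \<subseteq> ?R"
      proof
        fix t assume "t \<in> minimal_generators T"
        then obtain i' j' where "t = i' * n + j' * m + a" "irr i' j'"
          unfolding gens by blast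
        \<comment> \<open>Here the second coefficient is reduced instead, so \<open>i\<close> may be
          large.\<close>
        moreover define i j where "i = i' + j' div n * m" and "j = j' mod n"
        ultimately have t: "t = i * n + j * m + a" "irr i j" "j < n"
          using shift[of i' "j' div n" "j' mod n"] irr_unshift[of i' "j' mod n" "j' div n"] pos
          by auto
        have ij: "0 < i + j" using t(2) by (simp add: irr_def)
        have wrap: "t = (i - m) * n + (j + n) * m + a \<and> irr (i - m) (j + n)" if "m < i"
          using that t shift[of "i - m" 1 j] irr_shift[of "i - m" 1 j] by simp
        \<comment> \<open>Since \<open>\<mu> < n\<close>, the wrapped second coefficient exceeds
          \<open>\<mu>\<close>; once \<open>i - m\<close> reaches \<open>l\<close>, the bound
          \<open>irrD\<close> leaves room only for equality.\<close>
        have low: "i - m < l \<or> (i - m = l \<and> j + n \<le> \<mu> + 1)" if "m < i"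
          using irrD[of "i - m" "j + n"] wrap[OF that] \<open>\<mu> < n\<close> by linarith
        consider "i = 0" | "1 \<le> i" "i < l" | "i = l" | "l < i" "\<mu> \<le> j"
          | "l < i" "j < \<mu>" "i \<le> m" | "j < \<mu>" "m < i"
          by linarith
        then show "t \<in> ?R"
        proof cases
          case 1
          then have "1 \<le> j" "j \<le> n - 1" using ij t(3) by auto
          then show ?thesis using t(1) 1 by auto
        next
          case 2
          then have "i \<le> l - 1" "j \<le> n + \<mu> - 1" using t(3) by auto
          then show ?thesis using t(1) 2(1) by blast
        next
          case 3
          then have "j \<le> \<mu> + 1" using irrD[OF t(2)] by linarith
          then show ?thesis using t(1) 3 by blast
        next
          case 4
          then have "i = l + 1" "j = \<mu>" using irrD[OF t(2)] by linarith+
          then show ?thesis using t(1) a_n by simp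
        next
          case 5
          then have "l + 1 \<le> i" by simp
          then show ?thesis using t(1) 5 by blast
        next
          \<comment> \<open>Pairs beyond the last family are wrapped once. They land in the family
            below \<open>l\<close>, whose range up to \<open>n + \<mu> - 1\<close> fits
            \<open>j + n\<close>, or in the family at \<open>l\<close>.\<close>
          case 6
          show ?thesis
          proof (cases "i - m < l")
            case True
            then have "1 \<le> i - m" "i - m \<le> l - 1" "j + n \<le> n + \<mu> - 1"
              using 6 by auto
            then show ?thesis using wrap[OF 6(2)] by blast
          next
            case False
            then have "i - m = l" "j + n \<le> \<mu> + 1" using low[OF 6(2)] by auto
            then show ?thesis using wrap[OF 6(2)] by blast
          qed
        qed
      qed
      have 1: "y * m + a \<in> minimal_generators T" if "1 \<le> y" "y \<le> n - 1" for y
      proof -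
        have "irr 0 y" using that l by (intro irrI) auto
        then show ?thesis using genI[of 0 y] by simp
      qed
      have 2: "x * n + y * m + a \<in> minimal_generators T" if "1 \<le> x" "x \<le> l - 1" "y \<le> n + \<mu> - 1" for x y
        using that l pos by (intro genI irrI) auto
      have 3: "l * n + y * m + a \<in> minimal_generators T" if "y \<le> \<mu> + 1" for y
        using that l \<open>2 \<le> n\<close> pos by (intro genI irrI) auto
      \<comment> \<open>The value \<open>x = m\<close> is allowed because \<open>l > 0\<close> rules
        out a competing pair with first coefficient \<open>x - m\<close>.\<close>
      have 4: "x * n + y * m + a \<in> minimal_generators T" if "l + 1 \<le> x" "x \<le> m" "y < \<mu>" for x y
        using that l by (intro genI irrI) auto
      show "?R \<subseteq> minimal_generators T"
        by (safe; (rule gen_a_n | (rule 1; assumption) | (rule 2; assumption) | (rule 3; assumption) | (rule 4; assumption)))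
    qed
  qed
qed

end
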